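(* Let $\mathrm{Sha}=\mathcal{R}(C(t),tC^2(t))$ be the Shapiro array. Then $$\mathrm{Der}(\mathrm{Sha})=\mathcal{R}(C'(t),\,tC(t)),\qquad (\mathrm{Der}(\mathrm{Sha}))^{-1}=\mathcal{R}\big((1-t)^2(1-2t),\,t-t^2\big),$$ and for all $n\ge k\ge0$ the $(n,k)$-entry of $\mathrm{Der}(\mathrm{Sha})$ is $\binom{2n-k+2}{n-k}$.
   Context: $C(t)=\frac{1-\sqrt{1-4t}}{2t}$ is the Catalan generating function, satisfying $tC(t)^2=C(t)-1$. For formal power series $d(t),h(t)$ with $d(0)\neq0$, $h(0)=0$, $h'(0)\neq0$, $\mathcal{R}(d(t),h(t))$ is the infinite lower triangular matrix with $(n,k)$-entry $[t^n]\,d(t)h(t)^k$ ($n,k\ge0$); inverses are matrix inverses. $\mathrm{Der}(\mathcal{R}(d(t),h(t)))=\mathcal{R}(h'(t),t\,d(t))$. *)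

theory Defs
  imports "HOL-Computational_Algebra.Formal_Power_Series" "HOL-Algebra.Group"
begin

text \<open>Infinite lower triangular matrices over a field of characteristic 0 are functions
  of the row index and the column index.  In row \<open>n\<close> of a lower triangular matrix all
  entries beyond column \<open>n\<close> vanish, so the sum in the matrix product is finite.\<close>

definition lt_matrices :: "(nat \<Rightarrow> nat \<Rightarrow> 'a::field_char_0) monoid" where
  "lt_matrices =
     \<lparr> carrier = {A. \<forall>n k. n < k \<longrightarrow> A n k = 0},
       mult = (\<lambda>A B n k. \<Sum>j\<le>n. A n j * B j k),
       one = (\<lambda>n k. if n = k then 1 else 0) \<rparr>"

lemma monoid_lt_matrices: "monoid (lt_matrices :: (nat \<Rightarrow> nat \<Rightarrow> 'a::field_char_0) monoid)"
proof (rule monoidI)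
  fix A B C :: "nat \<Rightarrow> nat \<Rightarrow> 'a"
  assume A: "A \<in> carrier lt_matrices" and B: "B \<in> carrier lt_matrices"
    and C: "C \<in> carrier lt_matrices"
  show "A \<otimes>\<^bsub>lt_matrices\<^esub> B \<otimes>\<^bsub>lt_matrices\<^esub> C = A \<otimes>\<^bsub>lt_matrices\<^esub> (B \<otimes>\<^bsub>lt_matrices\<^esub> C)"
  proof (intro ext)
    fix n k
    have "(\<Sum>j\<le>n. (\<Sum>i\<le>n. A n i * B i j) * C j k) = (\<Sum>j\<le>n. \<Sum>i\<le>n. A n i * (B i j * C j k))"
      by (simp add: sum_distrib_right mult.assoc)
    also have "\<dots> = (\<Sum>i\<le>n. \<Sum>j\<le>n. A n i * (B i j * C j k))"
      by (rule sum.swap)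
    also have "\<dots> = (\<Sum>i\<le>n. \<Sum>j\<le>i. A n i * (B i j * C j k))"
    proof (rule sum.cong[OF refl], rule sum.mono_neutral_right)
      fix i assume "i \<in> {..n}"
      then show "{..i} \<subseteq> {..n}" by auto
      show "\<forall>j\<in>{..n} - {..i}. A n i * (B i j * C j k) = 0"
        using B by (auto simp: lt_matrices_def)
    qed simp
    finally show "(A \<otimes>\<^bsub>lt_matrices\<^esub> B \<otimes>\<^bsub>lt_matrices\<^esub> C) n k
        = (A \<otimes>\<^bsub>lt_matrices\<^esub> (B \<otimes>\<^bsub>lt_matrices\<^esub> C)) n k"
      by (simp add: lt_matrices_def sum_distrib_left)
  qed
next
  fix A :: "nat \<Rightarrow> nat \<Rightarrow> 'a"
  assume A: "A \<in> carrier lt_matrices"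
  show "\<one>\<^bsub>lt_matrices\<^esub> \<otimes>\<^bsub>lt_matrices\<^esub> A = A"
    by (intro ext) (simp add: lt_matrices_def if_distrib[of "\<lambda>x. x * _"] cong: if_cong)
  show "A \<otimes>\<^bsub>lt_matrices\<^esub> \<one>\<^bsub>lt_matrices\<^esub> = A"
    using A by (intro ext) (auto simp: lt_matrices_def if_distrib[of "\<lambda>x. _ * x"] cong: if_cong)
qed (auto simp: lt_matrices_def intro!: sum.neutral)

definition riordan :: "'a::field_char_0 fps \<Rightarrow> 'a fps \<Rightarrow> nat \<Rightarrow> nat \<Rightarrow> 'a" where
  "riordan d h n k = fps_nth (d * h ^ k) n"

definition riordan_pair :: "'a::field_char_0 fps \<Rightarrow> 'a fps \<Rightarrow> bool" where
  "riordan_pair d h \<longleftrightarrow>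
     fps_nth d 0 \<noteq> 0 \<and> fps_nth h 0 = 0 \<and> fps_nth (fps_deriv h) 0 \<noteq> 0"

text \<open>\<open>Der\<close> acts on matrices.  A Riordan array determines its pair of power series
  (lemma \<open>riordan_inject\<close>), so \<open>Der\<close> is well defined on Riordan arrays (lemma
  \<open>Der_riordan\<close>).\<close>

definition Der :: "(nat \<Rightarrow> nat \<Rightarrow> 'a::field_char_0) \<Rightarrow> nat \<Rightarrow> nat \<Rightarrow> 'a" where
  "Der A = (THE B. \<exists>d h. riordan_pair d h \<and> A = riordan d h \<and>
                          B = riordan (fps_deriv h) (fps_X * d))"

lemma riordan_inject:
  assumes "riordan_pair d h" and "riordan d h = riordan d' h'"
  shows "d' = d" and "h' = h"
proof -
  have eq: "d * h ^ k = d' * h' ^ k" for k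
    by (rule fps_ext) (use fun_cong[OF fun_cong[OF assms(2)]] in \<open>simp add: riordan_def\<close>)
  show d: "d' = d"
    using eq[of 0] by simp
  have "d \<noteq> 0"
    using assms(1) by (auto simp: riordan_pair_def)
  then show "h' = h"
    using eq[of 1] d by simp
qed

lemma Der_riordan:
  assumes "riordan_pair d h"
  shows "Der (riordan d h) = riordan (fps_deriv h) (fps_X * d)"
  unfolding Der_def
proof (rule the_equality)
  show "\<exists>d' h'. riordan_pair d' h' \<and> riordan d h = riordan d' h' \<and>
      riordan (fps_deriv h) (fps_X * d) = riordan (fps_deriv h') (fps_X * d')"
    using assms by blast
qed (use riordan_inject[OF assms] in blast)

text \<open>The first argument of \<^const>\<open>fps_radical\<close> supplies the root of the constant coefficient;
  here the square root of \<open>1 - 4t\<close> is the one with constant coefficient 1.  The division is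
  exact, as the numerator has constant coefficient 0.\<close>

definition catalan_gf :: "'a::field_char_0 fps" where
  "catalan_gf = (1 - fps_radical (\<lambda>_ _. 1) 2 (1 - 4 * fps_X)) / (2 * fps_X)"

lemma catalan_gf_eq:
  "fps_X * catalan_gf ^ 2 = (catalan_gf - 1 :: 'a::field_char_0 fps)"
proof -
  define s :: "'a fps" where "s = fps_radical (\<lambda>_ _. 1) 2 (1 - 4 * fps_X)"
  have s2: "s ^ 2 = 1 - 4 * fps_X"
    using power_radical[of "1 - 4 * fps_X :: 'a fps" "\<lambda>_ _. 1" 1]
    by (simp add: s_def numeral_2_eq_2)
  have "fps_nth (1 - s) 0 = 0"
    by (simp add: s_def)
  then have "1 - s = fps_X * fps_shift 1 (1 - s)"
    by (intro fps_ext) (auto simp: fps_X_mult_nth)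
  then obtain c where c: "1 - s = fps_X * c" ..
  have half: "(2 :: 'a fps) * fps_const (1/2) = 1"
    by (simp add: numeral_fps_const)
  have "1 - s = (2 * fps_const (1/2)) * (fps_X * c)"
    by (simp only: c half mult_1_left)
  then have num: "1 - s = (2 * fps_X) * (fps_const (1/2) * c)"
    by (simp only: ac_simps)
  then have "catalan_gf = fps_const (1/2) * c"
    by (simp add: catalan_gf_def flip: s_def)
  then have s: "s = 1 - 2 * fps_X * catalan_gf"
    using num by (simp add: algebra_simps)
  have "4 * fps_X * (fps_X * catalan_gf ^ 2) = 4 * fps_X * (catalan_gf - 1 :: 'a fps)"
    using s2 unfolding s by (simp add: power2_eq_square algebra_simps)
  then show ?thesis
    by simp
qed

definition Shapiro :: "nat \<Rightarrow> nat \<Rightarrow> 'a::field_char_0" where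
  "Shapiro = riordan catalan_gf (fps_X * catalan_gf ^ 2)"

end

theory Submission
  imports Defs
begin

text \<open>With \<open>u = t C\<close> the equation of the Catalan series reads \<open>u - u\<^sup>2 = t\<close>, so \<open>u\<close> and
  \<open>t - t\<^sup>2\<close> are compositional inverses of each other, and \<open>C (1 - u) = 1\<close>.  Differentiating gives
  \<open>C' (1 - u)\<^sup>2 (1 - 2u) = 1\<close>, whence the inverse array.  The entries are the coefficients of
  \<open>C' C\<^sup>k = C\<^bsup>k+2\<^esup> / (1 - 2u)\<close>; the series \<open>C\<^sup>j / (1 - 2u)\<close> satisfy Pascal's recurrence in \<open>j\<close>
  because \<open>C\<^bsup>j+1\<^esup> = C\<^sup>j + t C\<^bsup>j+2\<^esup>\<close>.\<close>

lemma riordan_in_carrier: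
  assumes "fps_nth h 0 = 0"
  shows "riordan d h \<in> carrier lt_matrices"
proof -
  have "fps_nth (d * h ^ k) n = 0" if "n < k" for n k
    unfolding fps_mult_nth
    by (rule sum.neutral) (use that startsby_zero_power_prefix[OF assms] in auto)
  then show ?thesis
    by (simp add: lt_matrices_def riordan_def)
qed

lemma riordan_one: "riordan 1 fps_X = \<one>\<^bsub>lt_matrices\<^esub>"
  by (intro ext) (simp add: riordan_def lt_matrices_def fps_X_power_iff)

text \<open>The fundamental theorem of Riordan arrays: applying \<open>riordan d h\<close> to the
  coefficient column of \<open>a\<close> gives the coefficients of
  \<open>d * (a oo h)\<close>.\<close>

lemma fps_mult_compose_nth:
  fixes a d h :: "'a::field fps"
  assumes "fps_nth h 0 = 0"
  shows "fps_nth (d * (a oo h)) n = (\<Sum>j\<le>n. fps_nth (d * h ^ j) n * fps_nth a j)"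
proof -
  \<comment> \<open>The bound is \<open>n\<close> for every \<open>m\<close>, so that the two sums
    below can be swapped; the extra terms vanish since \<open>h ^ j\<close> has no terms below
    degree \<open>j\<close>.\<close>
  have comp: "fps_nth (a oo h) m = (\<Sum>j\<le>n. fps_nth a j * fps_nth (h ^ j) m)" if "m \<le> n" for m
    unfolding fps_compose_nth
    by (rule sum.mono_neutral_left)
      (use that startsby_zero_power_prefix[OF assms] in auto)
  have "fps_nth (d * (a oo h)) n
      = (\<Sum>i=0..n. \<Sum>j\<le>n. fps_nth d i * (fps_nth a j * fps_nth (h ^ j) (n - i)))"
    by (simp add: fps_mult_nth comp sum_distrib_left)
  also have "\<dots> = (\<Sum>j\<le>n. \<Sum>i=0..n. fps_nth d i * (fps_nth a j * fps_nth (h ^ j) (n - i)))"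
    by (rule sum.swap)
  also have "\<dots> = (\<Sum>j\<le>n. fps_nth (d * h ^ j) n * fps_nth a j)"
    by (simp add: fps_mult_nth sum_distrib_left mult.commute mult.left_commute)
  finally show ?thesis .
qed

text \<open>Column \<open>k\<close> of the product is the left array applied to the series
  \<open>f * g ^ k\<close>, and composition with \<open>h\<close> is multiplicative.\<close>

lemma riordan_mult:
  assumes "fps_nth h 0 = 0"
  shows "riordan d h \<otimes>\<^bsub>lt_matrices\<^esub> riordan f g = riordan (d * (f oo h)) (g oo h)"
proof (intro ext)
  fix n k
  have "(riordan d h \<otimes>\<^bsub>lt_matrices\<^esub> riordan f g) n k = fps_nth (d * ((f * g ^ k) oo h)) n"
    by (simp add: lt_matrices_def riordan_def fps_mult_compose_nth[OF assms])
  also have "\<dots> = riordan (d * (f oo h)) (g oo h) n k"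
    using assms
    by (simp add: riordan_def fps_compose_mult_distrib fps_compose_power mult.assoc)
  finally show "(riordan d h \<otimes>\<^bsub>lt_matrices\<^esub> riordan f g) n k
      = riordan (d * (f oo h)) (g oo h) n k" .
qed

lemma (in monoid) Units_inv_eqI:
  assumes "x \<in> carrier G" "y \<in> carrier G" "x \<otimes> y = \<one>" "y \<otimes> x = \<one>"
  shows "x \<in> Units G \<and> inv x = y"
  using assms inv_unique'[of x y] by (auto simp: Units_def)

lemma catalan_power_div_nth:
  fixes c e :: "'a::field_char_0 fps"
  assumes c: "fps_X * c ^ 2 = c - 1" and e: "e * (1 - 2 * fps_X * c) = 1"
  shows "fps_nth (e * c ^ j) m = of_nat ((2 * m + j) choose m)"
proof (induction m arbitrary: j)
  case 0
  have "fps_nth (fps_X * c ^ 2) 0 = fps_nth (c - 1) 0"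
    by (simp only: c)
  moreover have "fps_nth (e * (1 - 2 * fps_X * c)) 0 = 1"
    by (simp add: e)
  ultimately show ?case
    by (simp add: fps_power_zeroth)
next
  case (Suc m)
  \<comment> \<open>This hypothesis holds for all exponents; it is saved because the inner induction
    on \<open>j\<close> reuses the name.\<close>
  note IH = Suc.IH
  show ?case
  proof (induction j)
    case 0
    \<comment> \<open>For \<open>j = 0\<close> this reduces the claim to the central binomial
      identity: (2m+2 choose m+1) is twice (2m+1 choose m).\<close>
    have "e = 1 + fps_X * (2 * (e * c ^ 1))"
      using e by (simp add: algebra_simps)
    then have "fps_nth e (Suc m) = fps_nth (1 + fps_X * (2 * (e * c ^ 1))) (Suc m)"
      by (rule arg_cong)
    also have "\<dots> = fps_nth (2 * (e * c ^ 1)) m"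
      by simp
    also have "\<dots> = 2 * fps_nth (e * c ^ 1) m"
      unfolding numeral_fps_const fps_mult_left_const_nth ..
    also have "\<dots> = 2 * of_nat ((2 * m + 1) choose m)"
      by (simp only: IH)
    also have "\<dots> = of_nat ((2 * Suc m) choose Suc m)"
    proof -
      have "(2 * m + 1) choose Suc m = (2 * m + 1) choose m"
        by (subst binomial_symmetric) auto
      then show ?thesis
        by simp
    qed
    finally show ?case
      by simp
  next
    case (Suc j)
    \<comment> \<open>Pascal's rule: both series on the right contribute binomials with upper index
      2m+j+2, with lower indices m+1 and m.\<close>
    have "e * c ^ Suc j = e * c ^ j + e * c ^ j * (c - 1)"
      by (simp add: algebra_simps)
    also have "\<dots> = e * c ^ j + fps_X * (e * c ^ (j + 2))"
      unfolding c[symmetric] by (simp add: power2_eq_square ac_simps)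
    finally have "fps_nth (e * c ^ Suc j) (Suc m)
        = fps_nth (e * c ^ j) (Suc m) + fps_nth (e * c ^ (j + 2)) m"
      by simp
    then show ?case
      by (simp only: Suc.IH IH) simp
  qed
qed

lemma catalan_gf_nth_0: "fps_nth catalan_gf 0 = 1"
  using arg_cong[OF catalan_gf_eq, of "\<lambda>f. fps_nth f 0"] by simp

lemma catalan_gf_mult_eq: "catalan_gf * (1 - fps_X * catalan_gf) = 1"
proof -
  have "catalan_gf * (1 - fps_X * catalan_gf) = catalan_gf - fps_X * catalan_gf ^ 2"
    by (simp add: algebra_simps power2_eq_square)
  then show ?thesis
    by (simp add: catalan_gf_eq)
qed

text \<open>With \<open>u = t C\<close>, differentiating \<open>t C^2 = C - 1\<close> gives
  \<open>C' (1 - 2u) = C^2\<close>; the factor \<open>(1 - u)^2\<close> then cancels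
  \<open>C^2\<close>.\<close>

lemma fps_deriv_catalan_gf:
  "fps_deriv catalan_gf * ((1 - fps_X * catalan_gf) ^ 2 * (1 - 2 * (fps_X * catalan_gf)))
    = (1 :: 'a::field_char_0 fps)"
proof -
  let ?c = "catalan_gf :: 'a fps" and ?d = "fps_deriv catalan_gf :: 'a fps"
  have "fps_deriv (fps_X * ?c ^ 2) = ?d"
    by (simp add: catalan_gf_eq)
  then have "?d * (1 - 2 * (fps_X * ?c)) = ?c ^ 2"
    by (simp add: power2_eq_square algebra_simps)
  then have "?d * ((1 - fps_X * ?c) ^ 2 * (1 - 2 * (fps_X * ?c))) = (?c * (1 - fps_X * ?c)) ^ 2"
    by (simp add: power_mult_distrib ac_simps)
  then show ?thesis
    by (simp add: catalan_gf_mult_eq)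
qed

lemma fps_X_catalan_gf_diff_square:
  "fps_X * catalan_gf - (fps_X * catalan_gf) ^ 2 = fps_X"
proof -
  have "fps_X * catalan_gf - (fps_X * catalan_gf) ^ 2
      = fps_X * (catalan_gf * (1 - fps_X * catalan_gf))"
    by (simp add: algebra_simps power2_eq_square)
  then show ?thesis
    by (simp add: catalan_gf_mult_eq)
qed

lemma fps_X_catalan_gf_compose:
  "(fps_X * catalan_gf) oo (fps_X - fps_X ^ 2) = (fps_X :: 'a::field_char_0 fps)"
proof -
  let ?g = "fps_X - fps_X ^ 2 :: 'a fps"
  define v where "v = (fps_X * catalan_gf) oo ?g"
  have "v - v ^ 2 = (fps_X * catalan_gf - (fps_X * catalan_gf) ^ 2) oo ?g"
    by (simp add: v_def fps_compose_sub_distrib fps_compose_power)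
  also have "\<dots> = ?g"
    by (simp add: fps_X_catalan_gf_diff_square)
  \<comment> \<open>Both \<open>v\<close> and \<open>fps_X\<close> are roots \<open>y\<close> of
    \<open>y - y^2 = t - t^2\<close>. The second factor has constant coefficient 1, so the first one
    must vanish.\<close>
  finally have "(v - fps_X) * (1 - v - fps_X) = 0"
    by (simp add: algebra_simps power2_eq_square)
  moreover have "fps_nth (1 - v - fps_X) 0 \<noteq> 0"
    by (simp add: v_def)
  then have "1 - v - fps_X \<noteq> 0"
    by force
  ultimately show ?thesis
    by (simp add: v_def)
qed

theorem theorem5p11:
  shows "Der (Shapiro :: nat \<Rightarrow> nat \<Rightarrow> 'a::field_char_0) =
           riordan (fps_deriv catalan_gf) (fps_X * catalan_gf) \<and>
         Der (Shapiro :: nat \<Rightarrow> nat \<Rightarrow> 'a) \<in> Units lt_matrices \<and>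
         inv\<^bsub>lt_matrices\<^esub> (Der (Shapiro :: nat \<Rightarrow> nat \<Rightarrow> 'a)) =
           riordan ((1 - fps_X) ^ 2 * (1 - 2 * fps_X)) (fps_X - fps_X ^ 2) \<and>
         (\<forall>n k. k \<le> n \<longrightarrow>
           Der (Shapiro :: nat \<Rightarrow> nat \<Rightarrow> 'a) n k = of_nat ((2 * n - k + 2) choose (n - k)))"
proof -
  let ?c = "catalan_gf :: 'a fps" and ?g = "fps_X - fps_X ^ 2 :: 'a fps"
  let ?u = "fps_X * ?c" and ?f = "(1 - fps_X) ^ 2 * (1 - 2 * fps_X) :: 'a fps"
  let ?A = "riordan (fps_deriv ?c) ?u" and ?B = "riordan ?f ?g"
  have u0: "fps_nth ?u 0 = 0" and g0: "fps_nth ?g 0 = 0"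
    by simp_all
  have "riordan_pair ?c (fps_X * ?c ^ 2)"
    by (simp add: riordan_pair_def catalan_gf_nth_0 fps_power_zeroth)
  \<comment> \<open>The second series \<open>t C^2\<close> of the Shapiro array equals
    \<open>C - 1\<close>, so its derivative is \<open>C'\<close>.\<close>
  then have Der: "Der Shapiro = ?A"
    by (simp add: Shapiro_def Der_riordan catalan_gf_eq)
  have f_comp: "?f oo h = (1 - h) ^ 2 * (1 - 2 * h)" if "fps_nth h 0 = 0" for h :: "'a fps"
    using that by (simp add: fps_compose_mult_distrib fps_compose_sub_distrib flip: fps_compose_power)
  have "?A \<otimes>\<^bsub>lt_matrices\<^esub> ?B = \<one>\<^bsub>lt_matrices\<^esub>"
  proof -
    have "?g oo ?u = fps_X"
      by (simp add: fps_compose_sub_distrib fps_X_catalan_gf_diff_square flip: fps_compose_power)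
    then show ?thesis
      by (simp only: riordan_mult[OF u0] f_comp[OF u0] fps_deriv_catalan_gf riordan_one)
  qed
  moreover have "?B \<otimes>\<^bsub>lt_matrices\<^esub> ?A = \<one>\<^bsub>lt_matrices\<^esub>"
  proof -
    \<comment> \<open>Since \<open>?u oo ?g\<close> is \<open>fps_X\<close>, the second product
      follows by composing the identity behind the first one with \<open>?g\<close>.\<close>
    have "?f oo fps_X = (?f oo ?u) oo ?g"
      by (simp only: fps_compose_assoc[OF g0 u0, symmetric] fps_X_catalan_gf_compose)
    then have "?f * (fps_deriv ?c oo ?g) = (fps_deriv ?c * (?f oo ?u)) oo ?g"
      by (simp add: fps_compose_mult_distrib[OF g0] mult.commute)
    also have "\<dots> = 1"
      by (simp only: f_comp[OF u0] fps_deriv_catalan_gf fps_compose_1)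
    finally show ?thesis
      by (simp only: riordan_mult[OF g0] fps_X_catalan_gf_compose riordan_one)
  qed
  ultimately have inv: "?A \<in> Units lt_matrices \<and> inv\<^bsub>lt_matrices\<^esub> ?A = ?B"
    using monoid.Units_inv_eqI[OF monoid_lt_matrices] riordan_in_carrier[OF u0]
      riordan_in_carrier[OF g0] by blast
  have entry: "?A n k = of_nat ((2 * n - k + 2) choose (n - k))" if "k \<le> n" for n k
  proof -
    \<comment> \<open>This is \<open>1 / (1 - 2u)\<close>, written without division.\<close>
    define e where "e = fps_deriv ?c * (1 - ?u) ^ 2"
    have e: "e * (1 - 2 * fps_X * ?c) = 1"
      using fps_deriv_catalan_gf[where 'a = 'a] by (simp add: e_def mult.assoc)
    have "e * ?c ^ (k + 2) = fps_deriv ?c * ?c ^ k * (?c * (1 - ?u)) ^ 2"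
      by (simp add: e_def power2_eq_square ac_simps)
    also have "\<dots> = fps_deriv ?c * ?c ^ k"
      by (simp add: catalan_gf_mult_eq)
    finally have "fps_deriv ?c * ?u ^ k = fps_X ^ k * (e * ?c ^ (k + 2))"
      by (simp only: power_mult_distrib ac_simps)
    \<comment> \<open>The factor \<open>fps_X ^ k\<close> shifts the index, so the coefficient
      formula applies with \<open>m = n - k\<close> and \<open>j = k + 2\<close>.\<close>
    then have "?A n k = fps_nth (e * ?c ^ (k + 2)) (n - k)"
      using that by (simp only: riordan_def fps_X_power_mult_nth) simp
    also have "\<dots> = of_nat ((2 * (n - k) + (k + 2)) choose (n - k))"
      by (rule catalan_power_div_nth[OF catalan_gf_eq e])
    also have "2 * (n - k) + (k + 2) = 2 * n - k + 2"
      using that by simp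
    finally show ?thesis .
  qed
  show ?thesis
    using Der inv entry by simp
qed

end
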